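(* Let $C,K,M,N$ be positive integers, let $\mathbf{X}\in\mathbb{R}^{C\times M\times N}$ be an input feature, $\mathbf{W}\in\mathbb{R}^{C\times K\times K}$ a convolutional filter, $b\in\mathbb{R}$ a bias, and let $Y=\mathbf{W}\otimes\mathbf{X}+b\cdot\mathbf{1}_{M\times N}\in\mathbb{R}^{M\times N}$ be the output of the convolution with circular padding and stride $1$. Let $\mathrm{Loss}$ be a real-valued differentiable function of $Y$, regarded as a function of $\mathbf{W}$ through $Y$, let $\eta\in\mathbb{R}$ be the learning rate, and let $\mathbf{W}'=\mathbf{W}-\eta\frac{\partial \mathrm{Loss}}{\partial\mathbf{W}}$ be the filter after one gradient descent step. Then for every frequency $(u,v)\in[0,M)\times[0,N)$, the change $\Delta\mathcal{F}_{\mathbf{W}}^{(uv)}=\mathcal{F}_{\mathbf{W}'}^{(uv)}-\mathcal{F}_{\mathbf{W}}^{(uv)}=\mathcal{T}_{uv}\big(\mathbf{W}-\eta\frac{\partial \mathrm{Loss}}{\partial\mathbf{W}}\big)-\mathcal{T}_{uv}(\mathbf{W})\in\mathbb{C}^C$ of the frequency component of the filter satisfies $$\Delta\mathcal{F}_{\mathbf{W}}^{(uv)}=-\eta\sum_{u'=0}^{M-1}\sum_{v'=0}^{N-1}A_{uvu'v'}\,\frac{\partial \mathrm{Loss}}{\partial\overline{\mathcal{F}}_{Y}^{(u'v')}}\cdot\overline{\mathcal{F}}_{\mathbf{X}}^{(u'v')},$$ where $$A_{uvu'v'}=\frac{\sin\left(\frac{K(u-u')\pi}{M}\right)}{\sin\left(\frac{(u-u')\pi}{M}\right)}\cdot\frac{\sin\left(\frac{K(v-v')\pi}{N}\right)}{\sin\left(\frac{(v-v')\pi}{N}\right)}\cdot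 e^{i\left(\frac{(K-1)(u-u')}{M}+\frac{(K-1)(v-v')}{N}\right)\pi}\in\mathbb{C}.$$
   Context: Here $i=\sqrt{-1}$, $\mathbf{1}_{M\times N}$ is the all-ones matrix, and an overline denotes (entrywise) complex conjugation. Convolution: writing $W^{(c)}_{ts}$ ($0\le t,s\le K-1$) and $X^{(c)}_{mn}$ ($0\le m\le M-1$, $0\le n\le N-1$) for the entries of the $c$-th channels ($1\le c\le C$) of $\mathbf{W}$ and $\mathbf{X}$, $$Y_{mn}=b+\sum_{c=1}^{C}\sum_{t=0}^{K-1}\sum_{s=0}^{K-1}W^{(c)}_{ts}X^{(c)}_{m+t,\,n+s},$$ where the spatial indices of $X^{(c)}$ are taken modulo $M$ and $N$ respectively (circular padding). Frequency components of features: for integers $0\le u\le M-1$, $0\le v\le N-1$, $G^{(c)}_{uv}=\sum_{m=0}^{M-1}\sum_{n=0}^{N-1}X^{(c)}_{mn}e^{-i(\frac{um}{M}+\frac{vn}{N})2\pi}$, $\mathcal{F}_{\mathbf{X}}^{(uv)}=[G^{(1)}_{uv},\dots,G^{(C)}_{uv}]^\top\in\mathbb{C}^C$, and $\mathcal{F}_Y^{(uv)}=H_{uv}=\sum_{m=0}^{M-1}\sum_{n=0}^{N-1}Y_{mn}e^{-i(\frac{um}{M}+\frac{vn}{N})2\pi}\in\mathbb{C}$. Frequency components of the filter: for real $u,v$, $\mathcal{F}_{\mathbf{W}}^{(uv)}=\mathcal{T}_{uv}(\mathbf{W})=[Q^{(1)}_{uv},\dots,Q^{(C)}_{uv}]^\top\in\mathbb{C}^C$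 with $Q^{(c)}_{uv}=\sum_{t=0}^{K-1}\sum_{s=0}^{K-1}W^{(c)}_{ts}e^{i(\frac{ut}{M}+\frac{vs}{N})2\pi}$. Gradient with respect to $\overline{\mathcal{F}}_Y$: by the chain rule through the inverse DFT $Y_{mn}=\frac1{MN}\sum_{u,v}H_{uv}e^{i(\frac{um}{M}+\frac{vn}{N})2\pi}$ (complex-gradient convention, with $\frac{\partial \mathrm{Loss}}{\partial \overline{Y}_{mn}}=\frac{\partial \mathrm{Loss}}{\partial Y_{mn}}$ because $Y$ is real), $$\frac{\partial \mathrm{Loss}}{\partial\overline{\mathcal{F}}_Y^{(uv)}}=\frac{\partial \mathrm{Loss}}{\partial\overline{H}_{uv}}=\frac{1}{MN}\sum_{m=0}^{M-1}\sum_{n=0}^{N-1}\frac{\partial \mathrm{Loss}}{\partial Y_{mn}}e^{-i(\frac{um}{M}+\frac{vn}{N})2\pi}\in\mathbb{C}.$$ The product $\frac{\partial \mathrm{Loss}}{\partial\overline{\mathcal{F}}_Y^{(u'v')}}\cdot\overline{\mathcal{F}}_{\mathbf{X}}^{(u'v')}$ is scalar times vector. Convention: in $A_{uvu'v'}$ a quotient $\sin(K x)/\sin(x)$ at $x=0$ is interpreted as its limit $K$. *)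

theory Defs
  imports "HOL-Analysis.Analysis" "Berlekamp_Zassenhaus.Finite_Field"
begin

text \<open>
  An \<open>M \<times> N\<close> array is a vector of type \<open>real ^ 'n mod_ring ^ 'm mod_ring\<close> with
  \<open>M = CARD('m)\<close> and \<open>N = CARD('n)\<close>: the index type \<open>'m mod_ring\<close> is the ring of integers
  modulo \<open>CARD('m)\<close>, so addition of spatial indices is circular.  A \<open>K \<times> K\<close> filter channel is
  indexed by \<open>'k mod_ring\<close> with \<open>K = CARD('k)\<close>; there only the enumeration \<open>0, \<dots>, K - 1\<close> of
  the indices is used, never their addition.  All cardinalities are arbitrary positive
  integers, since \<open>mod_ring\<close> over a one-element type is allowed.
\<close>

definition ix :: "nat \<Rightarrow> 'a::finite mod_ring" where
  "ix j = of_int_mod_ring (int j)"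

lemma bij_betw_ix: "bij_betw ix {..<CARD('a)} (UNIV :: 'a::finite mod_ring set)"
proof -
  have inj: "inj_on (ix :: nat \<Rightarrow> 'a mod_ring) {..<CARD('a)}"
  proof (rule inj_onI)
    fix x y assume xy: "x \<in> {..<CARD('a)}" "y \<in> {..<CARD('a)}"
      and eq: "(ix x :: 'a mod_ring) = ix y"
    have "to_int_mod_ring (ix j :: 'a mod_ring) = int j" if "j \<in> {..<CARD('a)}" for j
      unfolding ix_def by (rule to_int_mod_ring_of_int_mod_ring) (use that in auto)
    from this[OF xy(1)] this[OF xy(2)] have "int x = int y" unfolding eq by (rule trans[OF sym])
    then show "x = y" by (simp only: of_nat_eq_iff)
  qed
  have "ix ` {..<CARD('a)} = (UNIV :: 'a mod_ring set)"
    by (rule card_subset_eq) (simp_all add: card_image[OF inj])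
  with inj show ?thesis by (simp add: bij_betw_def)
qed

lemma ix_add: "(ix (m + t) :: 'a::finite mod_ring) = ix m + ix t"
  unfolding ix_def by transfer (simp add: mod_simps)

lemma ix_mod: "(ix (j mod CARD('a)) :: 'a::finite mod_ring) = ix j"
  unfolding ix_def by transfer (simp add: zmod_int)

text \<open>Stride 1; for the feature indices, \<open>m + ix t\<close> and \<open>n + ix s\<close> are taken modulo
  \<open>M\<close> and \<open>N\<close>.  The filter may be larger than the feature.\<close>

definition conv ::
  "real ^ 'k::finite mod_ring ^ 'k mod_ring ^ 'c::finite
    \<Rightarrow> real ^ 'n::finite mod_ring ^ 'm::finite mod_ring ^ 'c \<Rightarrow> real \<Rightarrow> real ^ 'n mod_ring ^ 'm mod_ring" where
  "conv W X b = (\<chi> m n. b + (\<Sum>c\<in>UNIV. \<Sum>t<CARD('k). \<Sum>s<CARD('k).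
      W $ c $ ix t $ ix s * X $ c $ (m + ix t) $ (n + ix s)))"

definition dft2 :: "real ^ 'n::finite mod_ring ^ 'm::finite mod_ring \<Rightarrow> nat \<Rightarrow> nat \<Rightarrow> complex" where
  "dft2 Z u v = (\<Sum>m<CARD('m). \<Sum>n<CARD('n). complex_of_real (Z $ ix m $ ix n) *
      exp (- \<i> * complex_of_real
        ((real u * real m / real CARD('m) + real v * real n / real CARD('n)) * (2 * pi))))"

definition feature_freq ::
  "real ^ 'n::finite mod_ring ^ 'm::finite mod_ring ^ 'c::finite \<Rightarrow> nat \<Rightarrow> nat \<Rightarrow> complex ^ 'c" where
  "feature_freq X u v = (\<chi> c. dft2 (X $ c) u v)"

text \<open>\<open>M\<close> and \<open>N\<close> are explicit because they are the feature dimensions, which the filter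
  does not determine; \<open>u\<close> and \<open>v\<close> need not be integers.\<close>

definition filter_freq ::
  "nat \<Rightarrow> nat \<Rightarrow> real \<Rightarrow> real \<Rightarrow> real ^ 'k::finite mod_ring ^ 'k mod_ring ^ 'c::finite \<Rightarrow> complex ^ 'c" where
  "filter_freq M N u v W = (\<chi> c. \<Sum>t<CARD('k). \<Sum>s<CARD('k).
      complex_of_real (W $ c $ ix t $ ix s) *
      exp (\<i> * complex_of_real ((u * real t / real M + v * real s / real N) * (2 * pi))))"

definition cnj_vec :: "complex ^ 'c::finite \<Rightarrow> complex ^ 'c" where
  "cnj_vec z = (\<chi> c. cnj (z $ c))"

text \<open>The array of partial derivatives.  On nested vector types \<open>Basis\<close> consists of the
  arrays with a single entry 1 and all others 0.\<close>

definition gradient :: "('a::euclidean_space \<Rightarrow> real) \<Rightarrow> 'a \<Rightarrow> 'a" where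
  "gradient f x = (\<Sum>e\<in>Basis. deriv (\<lambda>h. f (x + h *\<^sub>R e)) 0 *\<^sub>R e)"

lemma has_field_derivative_line:
  fixes f :: "'a::real_normed_vector \<Rightarrow> real"
  assumes "(f has_derivative D) (at x)"
  shows "((\<lambda>h. f (x + h *\<^sub>R e)) has_field_derivative D e) (at 0)"
proof -
  interpret bounded_linear D using assms by (rule has_derivative_bounded_linear)
  have "((\<lambda>h::real. x + h *\<^sub>R e) has_derivative (\<lambda>h. h *\<^sub>R e)) (at 0)"
    by (auto intro!: derivative_eq_intros)
  then have "((\<lambda>h. f (x + h *\<^sub>R e)) has_derivative (\<lambda>h. D (h *\<^sub>R e))) (at 0)"
    by (rule has_derivative_compose) (simp add: assms)
  moreover have "(\<lambda>h. D (h *\<^sub>R e)) = (*) (D e)"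
    by (rule ext) (simp only: scaleR real_scaleR_def mult.commute)
  ultimately show ?thesis
    by (simp only: has_field_derivative_def)
qed

lemma GDERIV_gradient:
  assumes "f differentiable (at x)"
  shows "GDERIV f x :> gradient f x"
proof -
  obtain D where D: "(f has_derivative D) (at x)"
    using assms by (auto simp: differentiable_def)
  interpret bounded_linear D using D by (rule has_derivative_bounded_linear)
  have g: "gradient f x = (\<Sum>e\<in>Basis. D e *\<^sub>R e)"
    unfolding gradient_def by (simp only: DERIV_imp_deriv[OF has_field_derivative_line[OF D]])
  have "D h = inner h (\<Sum>e\<in>Basis. D e *\<^sub>R e)" for h
  proof -
    have "D h = D (\<Sum>e\<in>Basis. inner h e *\<^sub>R e)" by (simp only: euclidean_representation)
    also have "\<dots> = (\<Sum>e\<in>Basis. inner h e * D e)" by (simp only: sum scaleR real_scaleR_def)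
    finally show ?thesis by (simp only: inner_sum_right inner_scaleR_right mult.commute)
  qed
  then have "D = (\<lambda>h. inner h (gradient f x))" unfolding g by (rule ext)
  with D show ?thesis by (simp only: gderiv_def)
qed

text \<open>The gradient of \<open>Loss\<close> with respect to the conjugate of the frequency component of its
  argument at \<open>(u, v)\<close>, at the array \<open>Y\<close>, as obtained from the chain rule through the inverse
  discrete Fourier transform; \<open>loss_freq_grad_complex_gradient\<close> below relates it to
  derivatives of \<open>Loss\<close> in the frequency domain.\<close>

definition loss_freq_grad ::
  "(real ^ 'n::finite mod_ring ^ 'm::finite mod_ring \<Rightarrow> real) \<Rightarrow> real ^ 'n mod_ring ^ 'm mod_ring
    \<Rightarrow> nat \<Rightarrow> nat \<Rightarrow> complex" where
  "loss_freq_grad Loss Y u v = 1 / (of_nat CARD('m) * of_nat CARD('n)) *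
     (\<Sum>m<CARD('m). \<Sum>n<CARD('n). complex_of_real (gradient Loss Y $ ix m $ ix n) *
       exp (- \<i> * complex_of_real
         ((real u * real m / real CARD('m) + real v * real n / real CARD('n)) * (2 * pi))))"

definition idft2 :: "(nat \<Rightarrow> nat \<Rightarrow> complex) \<Rightarrow> nat \<Rightarrow> nat \<Rightarrow> nat \<Rightarrow> nat \<Rightarrow> complex" where
  "idft2 H M N m n = 1 / (of_nat M * of_nat N) * (\<Sum>u<M. \<Sum>v<N. H u v *
      exp (\<i> * complex_of_real ((real u * real m / real M + real v * real n / real N) * (2 * pi))))"

definition array_of_freq :: "(nat \<Rightarrow> nat \<Rightarrow> complex) \<Rightarrow> real ^ 'n::finite mod_ring ^ 'm::finite mod_ring" where
  "array_of_freq H = (\<chi> m n. Re (idft2 H CARD('m) CARD('n)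
      (nat (to_int_mod_ring m)) (nat (to_int_mod_ring n))))"

lemma sum_ix: "(\<Sum>i\<in>(UNIV :: 'a::finite mod_ring set). f i) = (\<Sum>j<CARD('a). f (ix j))"
  by (rule sum.reindex_bij_betw[OF bij_betw_ix, symmetric])

lemma nat_to_int_ix: "j < CARD('a) \<Longrightarrow> nat (to_int_mod_ring (ix j :: 'a::finite mod_ring)) = j"
  by (simp add: ix_def)

lemma array_of_freq_nth:
  fixes H :: "nat \<Rightarrow> nat \<Rightarrow> complex"
  assumes "m < CARD('m)" "n < CARD('n)"
  shows "(array_of_freq H :: real ^ 'n::finite mod_ring ^ 'm::finite mod_ring) $ ix m $ ix n =
    Re (idft2 H CARD('m) CARD('n) m n)"
  using assms by (simp add: array_of_freq_def nat_to_int_ix)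

lemma array_eq_ixI:
  fixes A B :: "real ^ 'n::finite mod_ring ^ 'm::finite mod_ring"
  assumes "\<And>m n. m < CARD('m) \<Longrightarrow> n < CARD('n) \<Longrightarrow> A $ ix m $ ix n = B $ ix m $ ix n"
  shows "A = B"
proof -
  have "A $ i $ j = B $ i $ j" for i j
  proof -
    obtain m where "m < CARD('m)" "i = ix m"
      using bij_betw_ix[where 'a='m] by (metis UNIV_I bij_betw_def imageE lessThan_iff)
    moreover obtain n where "n < CARD('n)" "j = ix n"
      using bij_betw_ix[where 'a='n] by (metis UNIV_I bij_betw_def imageE lessThan_iff)
    ultimately show ?thesis using assms by simp
  qed
  then show ?thesis by (simp add: vec_eq_iff)
qed

lemma root_sum:
  assumes "m < M" "m' < M"
  shows "(\<Sum>u<M. exp (\<i> * complex_of_real (real u * (real m - real m') / real M * (2 * pi)))) =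
    (if m = m' then of_nat M else 0)"
proof (cases "m = m'")
  case False
  define z where "z = exp (\<i> * complex_of_real ((real m - real m') / real M * (2 * pi)))"
  have M: "M > 0" using assms by simp
  have "exp (\<i> * complex_of_real (real u * (real m - real m') / real M * (2 * pi))) = z ^ u" for u
    unfolding z_def by (simp flip: exp_of_nat_mult add: algebra_simps)
  moreover have "z ^ M = 1"
  proof -
    have r: "real M * ((real m - real m') / real M * (2 * pi)) = 2 * pi * real_of_int (int m - int m')"
      using M by (simp add: field_simps)
    have "z ^ M = exp (\<i> * complex_of_real (2 * pi * real_of_int (int m - int m')))"
      unfolding z_def r[symmetric] by (simp flip: exp_of_nat_mult add: mult.left_commute)
    also have "\<dots> = exp ((2 * of_int (int m - int m') * pi) * \<i>)" by (simp add: algebra_simps)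
    finally show ?thesis by (simp only: exp_integer_2pi Ints_of_int)
  qed
  moreover have "z \<noteq> 1"
  proof
    assume "z = 1"
    then obtain n :: int where n: "(real m - real m') / real M * (2 * pi) = of_int (2 * n) * pi"
      unfolding z_def exp_eq_1 by auto
    then have "(2 * pi) * ((real m - real m') / real M) = (2 * pi) * of_int n"
      by (simp add: mult_ac)
    then have "(real m - real m') / real M = of_int n"
      by (simp only: mult_left_cancel[of "2 * pi"] pi_neq_zero mult_eq_0_iff zero_neq_numeral[symmetric] simp_thms)
    then have "real m - real m' = of_int n * real M" using M by (simp add: divide_eq_eq)
    then have "of_int (int m - int m') = (of_int (n * int M) :: real)" by simp
    then have "int m - int m' = n * int M" by (simp only: of_int_eq_iff)
    moreover have "\<bar>int m - int m'\<bar> < int M" using assms by auto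
    ultimately have "\<bar>n\<bar> * int M < 1 * int M" by (simp add: abs_mult)
    then have "n = 0" by (simp only: mult_less_cancel_right) auto
    with \<open>int m - int m' = n * int M\<close> False show False by simp
  qed
  ultimately show ?thesis using False by (simp add: geometric_sum)
qed simp

lemma array_of_freq_dft2:
  fixes Y :: "real ^ 'n::finite mod_ring ^ 'm::finite mod_ring"
  shows "array_of_freq (dft2 Y) = Y"
proof (rule array_eq_ixI)
  fix m n assume mn: "m < CARD('m)" "n < CARD('n)"
  let ?M = "CARD('m)" and ?N = "CARD('n)"
  let ?e = "\<lambda>M u p q. exp (\<i> * complex_of_real (real u * (real p - real q) / real M * (2 * pi)))"
  have e: "exp (- \<i> * complex_of_real ((real u * real p / real ?M + real v * real q / real ?N) * (2 * pi))) *
      exp (\<i> * complex_of_real ((real u * real m / real ?M + real v * real n / real ?N) * (2 * pi)))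
      = ?e ?M u m p * ?e ?N v n q" for u v p q
    unfolding exp_add[symmetric] by (rule arg_cong[of _ _ exp])
      (simp add: algebra_simps diff_divide_distrib)
  have "(\<Sum>u<?M. \<Sum>v<?N. dft2 Y u v *
        exp (\<i> * complex_of_real ((real u * real m / real ?M + real v * real n / real ?N) * (2 * pi))))
    = (\<Sum>u<?M. \<Sum>v<?N. \<Sum>p<?M. \<Sum>q<?N. complex_of_real (Y $ ix p $ ix q) * (?e ?M u m p * ?e ?N v n q))"
    unfolding dft2_def sum_distrib_right by (simp only: mult.assoc e)
  also have "\<dots> = (\<Sum>u<?M. \<Sum>p<?M. \<Sum>v<?N. \<Sum>q<?N. complex_of_real (Y $ ix p $ ix q) * (?e ?M u m p * ?e ?N v n q))"
    by (intro sum.cong refl sum.swap)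
  also have "\<dots> = (\<Sum>p<?M. \<Sum>u<?M. \<Sum>v<?N. \<Sum>q<?N. complex_of_real (Y $ ix p $ ix q) * (?e ?M u m p * ?e ?N v n q))"
    by (rule sum.swap)
  also have "\<dots> = (\<Sum>p<?M. \<Sum>u<?M. \<Sum>q<?N. \<Sum>v<?N. complex_of_real (Y $ ix p $ ix q) * (?e ?M u m p * ?e ?N v n q))"
    by (intro sum.cong refl sum.swap)
  also have "\<dots> = (\<Sum>p<?M. \<Sum>q<?N. \<Sum>u<?M. \<Sum>v<?N. complex_of_real (Y $ ix p $ ix q) * (?e ?M u m p * ?e ?N v n q))"
    by (intro sum.cong refl sum.swap)
  also have "\<dots> = (\<Sum>p<?M. \<Sum>q<?N. complex_of_real (Y $ ix p $ ix q) * ((\<Sum>u<?M. ?e ?M u m p) * (\<Sum>v<?N. ?e ?N v n q)))"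
    by (intro sum.cong refl) (subst sum_product, simp only: sum_distrib_left)
  also have "\<dots> = (\<Sum>p<?M. \<Sum>q<?N. complex_of_real (Y $ ix p $ ix q) *
      ((if m = p then of_nat ?M else 0) * (if n = q then of_nat ?N else 0)))"
    using mn by (intro sum.cong refl) (simp only: root_sum lessThan_iff)
  also have "\<dots> = (\<Sum>p<?M. \<Sum>q<?N. if q = n then if p = m then
      complex_of_real (Y $ ix p $ ix q) * (of_nat ?M * of_nat ?N) else 0 else 0)"
    by (intro sum.cong refl) simp
  also have "\<dots> = complex_of_real (Y $ ix m $ ix n) * (of_nat ?M * of_nat ?N)"
    using mn by (simp add: sum.delta)
  finally have "idft2 (dft2 Y) ?M ?N m n = complex_of_real (Y $ ix m $ ix n)"
    unfolding idft2_def by simp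
  then show "(array_of_freq (dft2 Y) :: real ^ 'n mod_ring ^ 'm mod_ring) $ ix m $ ix n = Y $ ix m $ ix n"
    using mn by (simp add: array_of_freq_nth)
qed

text \<open>For complex frequency components \<open>H\<close> that need not come from a real array, \<open>Loss\<close> is
  applied to the real part of the inverse transform; the complex gradient is the convention
  \<open>\<partial>/\<partial>Re + \<i> \<partial>/\<partial>Im\<close>, under which the gradient with respect to a real variable is the
  ordinary one.\<close>

lemma loss_freq_grad_complex_gradient:
  fixes Loss :: "real ^ 'n::finite mod_ring ^ 'm::finite mod_ring \<Rightarrow> real"
  assumes Loss: "Loss differentiable (at Y)" and uv: "u < CARD('m)" "v < CARD('n)"
  defines "L \<equiv> \<lambda>z. Loss (array_of_freq ((dft2 Y)(u := (dft2 Y u)(v := dft2 Y u v + z))))"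
  shows "loss_freq_grad Loss Y u v =
    complex_of_real (deriv (\<lambda>h. L (complex_of_real h)) 0) +
    \<i> * complex_of_real (deriv (\<lambda>h. L (\<i> * complex_of_real h)) 0)"
proof -
  let ?M = "CARD('m)" and ?N = "CARD('n)"
  define \<theta> where "\<theta> m n = (real u * real m / real ?M + real v * real n / real ?N) * (2 * pi)" for m n
  define E :: "complex \<Rightarrow> real ^ 'n mod_ring ^ 'm mod_ring"
    where "E w = (\<chi> m n. Re (w * exp (\<i> * complex_of_real
      (\<theta> (nat (to_int_mod_ring m)) (nat (to_int_mod_ring n)))) / (of_nat ?M * of_nat ?N)))" for w
  have E_nth: "E w $ ix m $ ix n = Re (w * exp (\<i> * complex_of_real (\<theta> m n)) / (of_nat ?M * of_nat ?N))"
    if "m < ?M" "n < ?N" for w m n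
    using that by (simp add: E_def nat_to_int_ix)
  have L: "L (complex_of_real h * w) = Loss (Y + h *\<^sub>R E w)" for h w
  proof -
    have "idft2 ((dft2 Y)(u := (dft2 Y u)(v := dft2 Y u v + z))) ?M ?N m n
        = idft2 (dft2 Y) ?M ?N m n + z * exp (\<i> * complex_of_real (\<theta> m n)) / (of_nat ?M * of_nat ?N)"
      for z m n
    proof -
      let ?f = "\<lambda>p q. exp (\<i> * complex_of_real ((real p * real m / real ?M + real q * real n / real ?N) * (2 * pi)))"
      have "(\<Sum>p<?M. \<Sum>q<?N. ((dft2 Y)(u := (dft2 Y u)(v := dft2 Y u v + z))) p q * ?f p q)
        = (\<Sum>p<?M. \<Sum>q<?N. dft2 Y p q * ?f p q + (if q = v then (if p = u then z * ?f p q else 0) else 0))"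
        by (intro sum.cong refl) (auto simp: algebra_simps)
      also have "\<dots> = (\<Sum>p<?M. \<Sum>q<?N. dft2 Y p q * ?f p q) + z * ?f u v"
        using uv by (simp add: sum.distrib sum.delta)
      finally show ?thesis by (simp add: idft2_def \<theta>_def add_divide_distrib)
    qed
    then have "array_of_freq ((dft2 Y)(u := (dft2 Y u)(v := dft2 Y u v + complex_of_real h * w)))
        = array_of_freq (dft2 Y) + h *\<^sub>R E w"
      by (intro array_eq_ixI) (simp add: array_of_freq_nth E_nth mult.assoc Re_divide_of_nat
        flip: of_nat_mult)
    then show ?thesis by (simp add: L_def array_of_freq_dft2)
  qed
  have grad: "(Loss has_derivative (\<lambda>h. inner h (gradient Loss Y))) (at Y)"
    using GDERIV_gradient[OF Loss] by (simp add: gderiv_def)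
  have D: "deriv (\<lambda>h. L (complex_of_real h * w)) 0 = (\<Sum>m<?M. \<Sum>n<?N.
      Re (w * exp (\<i> * complex_of_real (\<theta> m n)) / (of_nat ?M * of_nat ?N)) * gradient Loss Y $ ix m $ ix n)" for w
    unfolding L DERIV_imp_deriv[OF has_field_derivative_line[OF grad]] inner_vec_def sum_ix
    by (intro sum.cong refl) (simp add: E_nth)
  have cis: "Re (1 * exp (\<i> * complex_of_real t) / (of_nat ?M * of_nat ?N)) = cos t / (real ?M * real ?N)"
    "Re (\<i> * exp (\<i> * complex_of_real t) / (of_nat ?M * of_nat ?N)) = - sin t / (real ?M * real ?N)"
    "exp (- \<i> * complex_of_real t) = complex_of_real (cos t) - \<i> * complex_of_real (sin t)" for t
    by (simp_all add: exp_Euler exp_minus_Euler cos_of_real sin_of_real flip: of_nat_mult)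
  have "complex_of_real (deriv (\<lambda>h. L (complex_of_real h * 1)) 0) +
    \<i> * complex_of_real (deriv (\<lambda>h. L (complex_of_real h * \<i>)) 0) = loss_freq_grad Loss Y u v"
    unfolding D cis loss_freq_grad_def \<theta>_def[symmetric] of_real_sum sum_distrib_left sum.distrib[symmetric]
    by (intro sum.cong refl) (simp add: field_simps)
  then show ?thesis by (simp add: mult.commute)
qed

text \<open>\<open>sin (K x) / sin x\<close>, with its limit \<open>K\<close> as the value at \<open>x = 0\<close>.\<close>

definition sin_ratio :: "nat \<Rightarrow> real \<Rightarrow> real" where
  "sin_ratio K x = (if x = 0 then real K else sin (real K * x) / sin x)"

definition freq_coupling ::
  "nat \<Rightarrow> nat \<Rightarrow> nat \<Rightarrow> real \<Rightarrow> real \<Rightarrow> nat \<Rightarrow> nat \<Rightarrow> complex" where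
  "freq_coupling K M N u v u' v' =
     complex_of_real (sin_ratio K ((u - real u') * pi / real M)) *
     complex_of_real (sin_ratio K ((v - real v') * pi / real N)) *
     exp (\<i> * complex_of_real
       (((real K - 1) * (u - real u') / real M + (real K - 1) * (v - real v') / real N) * pi))"

end

theory Submission
  imports Defs
begin

text \<open>Each partial derivative of the loss with respect to a filter entry is the inner product of
  \<open>\<partial>Loss/\<partial>Y\<close> with a translate of an input channel.  Parseval's identity moves that inner
  product to the frequency domain, where the translation by \<open>(t, s)\<close> becomes multiplication by
  characters.  Applying \<open>\<T>\<^sub>u\<^sub>v\<close> sums these characters against
  \<open>exp (2\<pi>\<i> (u t / M + v s / N))\<close> over \<open>0 \<le> t, s < K\<close>; the two resulting geometric sums are
  the Dirichlet kernels in \<open>A\<^sub>u\<^sub>v\<^sub>u\<^sub>'\<^sub>v\<^sub>'\<close>.\<close>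

section \<open>Characters of the cyclic index groups\<close>

text \<open>The DFT kernel as a function on the index ring itself, so that sums can run over
  \<open>UNIV\<close> and be reindexed by translation; the frequency stays a natural number.\<close>

definition character :: "nat \<Rightarrow> 'a::finite mod_ring \<Rightarrow> complex" where
  "character u i = cis (- (2 * pi * (real u * real (nat (to_int_mod_ring i)) / real CARD('a))))"

lemma ix_cases:
  obtains j where "j < CARD('a)" "(i :: 'a::finite mod_ring) = ix j"
  using bij_betw_ix[where 'a='a] by (metis UNIV_I bij_betw_def imageE lessThan_iff)

lemma ix_eq_iff:
  "j < CARD('a) \<Longrightarrow> k < CARD('a) \<Longrightarrow> (ix j :: 'a::finite mod_ring) = ix k \<longleftrightarrow> j = k"
  using bij_betw_ix[where 'a='a] by (auto simp: bij_betw_def inj_on_def)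

text \<open>Here \<open>j\<close> is arbitrary: a filter offset \<open>t < K\<close> may exceed the
  feature size, and circular padding then wraps it around.\<close>

lemma character_ix:
  "character u (ix j :: 'a::finite mod_ring) = cis (- (2 * pi * (real u * real j / real CARD('a))))"
proof -
  let ?M = "CARD('a)"
  have "(ix j :: 'a mod_ring) = ix (j mod ?M)" by (simp only: ix_mod)
  then have "character u (ix j :: 'a mod_ring) = cis (- (2 * pi * (real u * real (j mod ?M) / real ?M)))"
    by (simp add: character_def nat_to_int_ix)
  \<comment> \<open>The inserted factor is 1, a whole number of turns since
    \<open>u * (j div M)\<close> is an integer; it restores \<open>j\<close> from
    \<open>j mod M\<close>.\<close>
  also have "\<dots> = cis (- (2 * pi * (real u * real (j mod ?M) / real ?M)))
      * cis (2 * pi * (- real (u * (j div ?M))))"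
    by (simp only: cis_multiple_2pi Ints_minus Ints_of_nat mult_1_right)
  also have "\<dots> = cis (- (2 * pi * (real u * real j / real ?M)))"
  proof -
    have "real j = real (?M * (j div ?M) + j mod ?M)" by simp
    also have "\<dots> = real ?M * real (j div ?M) + real (j mod ?M)" by (simp only: of_nat_add of_nat_mult)
    finally have j: "real j = real ?M * real (j div ?M) + real (j mod ?M)" .
    have M: "real ?M \<noteq> 0" by simp
    show ?thesis
      unfolding cis_mult
      by (rule arg_cong[of _ _ cis], subst j) (use M in \<open>simp add: field_simps\<close>)
  qed
  finally show ?thesis .
qed

lemma character_add: "character u (i + j) = character u i * character u j"
proof -
  obtain k l where "i = ix k" "j = ix l" by (metis ix_cases)
  then show ?thesis
    by (simp add: ix_add[symmetric] character_ix cis_mult algebra_simps add_divide_distrib)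
qed

lemma norm_character [simp]: "norm (character u i) = 1"
  by (simp add: character_def)

lemma character_orthogonal:
  fixes i j :: "'a::finite mod_ring"
  shows "(\<Sum>u<CARD('a). character u i * cnj (character u j)) = (if i = j then of_nat CARD('a) else 0)"
proof -
  obtain k l where k: "k < CARD('a)" "i = ix k" and l: "l < CARD('a)" "j = ix l"
    by (metis ix_cases)
  \<comment> \<open>Characters carry a negative angle and conjugation flips the second one, so the
    difference is \<open>l - k\<close> and \<open>root_sum\<close> is applied in that order.\<close>
  have "character u i * cnj (character u j) =
      exp (\<i> * complex_of_real (real u * (real l - real k) / real CARD('a) * (2 * pi)))" for u
    unfolding k l character_ix cis_cnj cis_mult cis_conv_exp[symmetric]
    by (rule arg_cong[of _ _ cis]) (simp add: algebra_simps diff_divide_distrib)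
  then show ?thesis
    using root_sum[OF l(1) k(1)] ix_eq_iff[OF l(1) k(1)] by (auto simp: k l)
qed

section \<open>Translation and Parseval for the two-dimensional transform\<close>

lemma dft2_character:
  fixes Z :: "real ^ 'n::finite mod_ring ^ 'm::finite mod_ring"
  shows "dft2 Z u v =
    (\<Sum>i\<in>UNIV. \<Sum>j\<in>UNIV. complex_of_real (Z $ i $ j) * (character u i * character v j))"
proof -
  have cis: "exp (- \<i> * complex_of_real x) = cis (- x)" for x
    by (simp add: cis_conv_exp)
  show ?thesis
    unfolding sum_ix dft2_def character_ix cis_mult cis by (simp add: algebra_simps)
qed

text \<open>The characters are multiplicative and \<open>i \<mapsto> i + a\<close> permutes the
  cyclic index ring, so the substitution leaves the sum unchanged.\<close>

lemma dft2_translate: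
  fixes Z :: "real ^ 'n::finite mod_ring ^ 'm::finite mod_ring"
  shows "dft2 (\<chi> i j. Z $ (i + a) $ (j + b)) u v * (character u a * character v b) = dft2 Z u v"
proof -
  let ?f = "\<lambda>i j. complex_of_real (Z $ i $ j) * (character u i * character v j)"
  have bij: "bij_betw (\<lambda>i. i + c) UNIV UNIV" for c :: "'x::finite mod_ring"
    by (rule bij_betwI[where g = "\<lambda>i. i - c"]) auto
  have "dft2 (\<chi> i j. Z $ (i + a) $ (j + b)) u v * (character u a * character v b)
      = (\<Sum>i\<in>UNIV. \<Sum>j\<in>UNIV. ?f (i + a) (j + b))"
    unfolding dft2_character sum_distrib_right by (simp add: character_add mult_ac)
  also have "\<dots> = (\<Sum>i\<in>UNIV. \<Sum>j\<in>UNIV. ?f (i + a) j)"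
    by (intro sum.cong refl sum.reindex_bij_betw[OF bij])
  also have "\<dots> = (\<Sum>i\<in>UNIV. \<Sum>j\<in>UNIV. ?f i j)"
    by (rule sum.reindex_bij_betw[OF bij])
  finally show ?thesis by (simp only: dft2_character)
qed

text \<open>Expanding both transforms and summing over frequencies first leaves only the diagonal,
  by orthogonality of characters. The factor \<open>M * N\<close> appears because the transform is
  unnormalised.\<close>

lemma dft2_parseval:
  fixes A B :: "real ^ 'n::finite mod_ring ^ 'm::finite mod_ring"
  shows "(\<Sum>u<CARD('m). \<Sum>v<CARD('n). dft2 A u v * cnj (dft2 B u v)) =
    of_nat CARD('m) * of_nat CARD('n) * complex_of_real (inner A B)"
proof -
  let ?M = "CARD('m)" and ?N = "CARD('n)"
  \<comment> \<open>Row and column are packed into one index, which reduces the six nested sums to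
    three.\<close>
  let ?P = "UNIV :: ('m mod_ring \<times> 'n mod_ring) set"
  define \<phi> where "\<phi> w p = character (fst w) (fst p) * character (snd w) (snd p)"
    for w and p :: "'m mod_ring \<times> 'n mod_ring"
  define el where "el Z p = complex_of_real (Z $ fst p $ snd p)"
    for Z :: "real ^ 'n mod_ring ^ 'm mod_ring" and p
  have dft: "dft2 Z u v = (\<Sum>p\<in>?P. el Z p * \<phi> (u, v) p)" for Z :: "real ^ 'n mod_ring ^ 'm mod_ring" and u v
    unfolding dft2_character sum.cartesian_product UNIV_Times_UNIV
    by (simp add: el_def \<phi>_def case_prod_unfold)
  have orth: "(\<Sum>w\<in>{..<?M}\<times>{..<?N}. \<phi> w p * cnj (\<phi> w q)) = (if p = q then of_nat ?M * of_nat ?N else 0)" for p q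
  proof -
    have "(\<Sum>w\<in>{..<?M}\<times>{..<?N}. \<phi> w p * cnj (\<phi> w q)) =
      (\<Sum>u<?M. character u (fst p) * cnj (character u (fst q))) *
      (\<Sum>v<?N. character v (snd p) * cnj (character v (snd q)))"
      unfolding sum_product sum.cartesian_product
      by (intro sum.cong refl) (auto simp: \<phi>_def)
    then show ?thesis by (simp add: character_orthogonal prod_eq_iff)
  qed
  have "(\<Sum>u<?M. \<Sum>v<?N. dft2 A u v * cnj (dft2 B u v)) =
      (\<Sum>w\<in>{..<?M}\<times>{..<?N}. \<Sum>p\<in>?P. \<Sum>q\<in>?P. el A p * el B q * (\<phi> w p * cnj (\<phi> w q)))"
    unfolding dft cnj_sum sum_product
    by (subst sum.cartesian_product, intro sum.cong refl) (auto simp: el_def mult_ac intro!: sum.cong)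
  also have "\<dots> = (\<Sum>p\<in>?P. \<Sum>w\<in>{..<?M}\<times>{..<?N}. \<Sum>q\<in>?P. el A p * el B q * (\<phi> w p * cnj (\<phi> w q)))"
    by (rule sum.swap)
  also have "\<dots> = (\<Sum>p\<in>?P. \<Sum>q\<in>?P. \<Sum>w\<in>{..<?M}\<times>{..<?N}. el A p * el B q * (\<phi> w p * cnj (\<phi> w q)))"
    by (intro sum.cong refl sum.swap)
  also have "\<dots> = (\<Sum>p\<in>?P. \<Sum>q\<in>?P. if p = q then of_nat ?M * of_nat ?N * (el A p * el B q) else 0)"
    unfolding sum_distrib_left[symmetric] orth by (intro sum.cong refl) simp
  also have "\<dots> = of_nat ?M * of_nat ?N * (\<Sum>p\<in>?P. el A p * el B p)"
    by (simp add: sum_distrib_left)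
  also have "(\<Sum>p\<in>?P. el A p * el B p) = complex_of_real (inner A B)"
    by (simp add: inner_vec_def sum.cartesian_product el_def case_prod_unfold)
  finally show ?thesis .
qed

section \<open>Dirichlet kernels and the coupling coefficients\<close>

text \<open>A geometric sum with ratio \<open>cis (2 * x)\<close>. The bound on \<open>x\<close>
  makes \<open>sin x\<close> vanish only at \<open>x = 0\<close>, where every summand is 1 and
  \<open>sin_ratio\<close> takes its limit value \<open>K\<close>.\<close>

lemma sum_cis_sin_ratio:
  assumes "\<bar>x\<bar> < pi"
  shows "(\<Sum>t<K. cis (2 * x * real t)) = complex_of_real (sin_ratio K x) * cis ((real K - 1) * x)"
proof (cases "x = 0")
  case False
  have s: "sin x \<noteq> 0"
    using False assms sin_gt_zero[of x] sin_gt_zero[of "- x"] by (cases "x > 0") auto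
  \<comment> \<open>Extracting the half angle from numerator and denominator produces the quotient
    of sines and leaves a pure phase.\<close>
  have chord: "cis (2 * y) - 1 = 2 * \<i> * complex_of_real (sin y) * cis y" for y
    by (rule complex_eqI) (simp_all add: cos_double_sin sin_double power2_eq_square)
  have "cis (2 * x) \<noteq> 1"
    using chord[of x] s by auto
  moreover have "cis (2 * x * real t) = cis (2 * x) ^ t" for t
    unfolding Complex.DeMoivre by (simp only: mult_ac)
  ultimately have "(\<Sum>t<K. cis (2 * x * real t)) = (cis (2 * x) ^ K - 1) / (cis (2 * x) - 1)"
    by (simp add: geometric_sum)
  also have "cis (2 * x) ^ K = cis (2 * (real K * x))"
    by (simp add: Complex.DeMoivre mult_ac)
  also have "(cis (2 * (real K * x)) - 1) / (cis (2 * x) - 1)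
      = complex_of_real (sin (real K * x) / sin x) * (cis (real K * x) / cis x)"
    unfolding chord using s by simp
  also have "cis (real K * x) / cis x = cis ((real K - 1) * x)"
    by (simp add: cis_divide algebra_simps)
  finally show ?thesis using False by (simp add: sin_ratio_def)
qed (simp add: sin_ratio_def)

text \<open>The double sum factors into two Dirichlet kernels. Since \<open>u\<close> and
  \<open>u'\<close> both lie in \<open>[0, M)\<close>, the angle \<open>(u - u') * pi / M\<close>
  lies strictly between \<open>-pi\<close> and \<open>pi\<close>, even for non-integral
  \<open>u\<close>; likewise for \<open>v\<close>.\<close>

lemma freq_coupling_eq_sum:
  assumes "0 \<le> u" "u < real CARD('m::finite)" "0 \<le> v" "v < real CARD('n::finite)"
    and "u' < CARD('m)" "v' < CARD('n)"
  shows "freq_coupling K CARD('m) CARD('n) u v u' v' = (\<Sum>t<K. \<Sum>s<K.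
    exp (\<i> * complex_of_real ((u * real t / real CARD('m) + v * real s / real CARD('n)) * (2 * pi))) *
    (character u' (ix t :: 'm mod_ring) * character v' (ix s :: 'n mod_ring)))"
proof -
  let ?M = "CARD('m)" and ?N = "CARD('n)"
  let ?x = "(u - real u') * pi / real ?M" and ?y = "(v - real v') * pi / real ?N"
  have bound: "\<bar>(r - real k) * pi / real L\<bar> < pi" if "0 \<le> r" "r < real L" "k < L" for r k L
  proof -
    have "\<bar>r - real k\<bar> < real L" using that by (simp add: abs_less_iff)
    then have "\<bar>r - real k\<bar> * pi < real L * pi" by (simp add: mult_strict_right_mono)
    then show ?thesis using that by (simp add: abs_mult divide_less_eq mult.commute)
  qed
  have "freq_coupling K ?M ?N u v u' v' =
      (complex_of_real (sin_ratio K ?x) * cis ((real K - 1) * ?x)) *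
      (complex_of_real (sin_ratio K ?y) * cis ((real K - 1) * ?y))"
  proof -
    have "((real K - 1) * (u - real u') / real ?M + (real K - 1) * (v - real v') / real ?N) * pi
        = (real K - 1) * ?x + (real K - 1) * ?y" by (simp add: distrib_right)
    then show ?thesis
      unfolding freq_coupling_def cis_conv_exp[symmetric] by (simp only: cis_mult[symmetric] mult_ac)
  qed
  also have "\<dots> = (\<Sum>t<K. cis (2 * ?x * real t)) * (\<Sum>s<K. cis (2 * ?y * real s))"
    using assms by (simp only: sum_cis_sin_ratio bound)
  also have "\<dots> = (\<Sum>t<K. \<Sum>s<K. cis (2 * ?x * real t) * cis (2 * ?y * real s))"
    by (rule sum_product)
  finally show ?thesis
    unfolding character_ix cis_conv_exp[symmetric] cis_mult
    by (simp only:) (intro sum.cong refl arg_cong[of _ _ cis], simp add: algebra_simps diff_divide_distrib)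
qed

section \<open>Gradient of the loss with respect to the filter\<close>

text \<open>Convolution is affine in the filter; setting the bias to zero gives its linear
  part.\<close>

lemma conv_has_derivative:
  fixes W :: "real ^ 'k::finite mod_ring ^ 'k mod_ring ^ 'c::finite"
  shows "((\<lambda>V. conv V X b) has_derivative (\<lambda>V. conv V X 0)) (at W)"
proof -
  have "bounded_linear (\<lambda>V. conv V X 0)"
    unfolding linear_conv_bounded_linear[symmetric]
    by (rule linearI)
      (simp_all add: conv_def vec_eq_iff sum.distrib distrib_right sum_distrib_left mult.assoc)
  then have "((\<lambda>V. (\<chi> i j. b) + conv V X 0) has_derivative (\<lambda>V. conv V X 0)) (at W)"
    using has_derivative_add[OF has_derivative_const bounded_linear_imp_has_derivative] by fastforce
  moreover have "(\<chi> i j. b) + conv V X 0 = conv V X b" for V :: "real ^ 'k mod_ring ^ 'k mod_ring ^ 'c"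
    by (simp add: conv_def vec_eq_iff)
  ultimately show ?thesis by simp
qed

lemma inner_gradient:
  assumes "(f has_derivative D) (at x)"
  shows "inner h (gradient f x) = D h"
proof -
  have "f differentiable (at x)" using assms by (rule differentiableI)
  then have "(f has_derivative (\<lambda>h. inner h (gradient f x))) (at x)"
    by (simp only: GDERIV_gradient flip: gderiv_def)
  from has_derivative_unique[OF this assms] show ?thesis by (rule fun_cong)
qed

text \<open>By the chain rule, pairing the gradient with a unit filter \<open>?e\<close> equals
  pairing \<open>gradient Loss\<close> with the convolution of \<open>?e\<close>, which is a
  translate of one input channel.\<close>

lemma gradient_conv:
  fixes X :: "real ^ 'n::finite mod_ring ^ 'm::finite mod_ring ^ 'c::finite"
    and W :: "real ^ 'k::finite mod_ring ^ 'k mod_ring ^ 'c"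
  assumes Loss: "Loss differentiable (at (conv W X b))" and ts: "t < CARD('k)" "s < CARD('k)"
  shows "gradient (\<lambda>V. Loss (conv V X b)) W $ c $ ix t $ ix s =
    inner (gradient Loss (conv W X b)) (\<chi> i j. X $ c $ (i + ix t) $ (j + ix s))"
proof -
  let ?g = "gradient Loss (conv W X b)"
  let ?e = "axis c (axis (ix t) (axis (ix s) 1)) :: real ^ 'k mod_ring ^ 'k mod_ring ^ 'c"
  have "(Loss has_derivative (\<lambda>h. inner h ?g)) (at (conv W X b))"
    using GDERIV_gradient[OF Loss] by (simp add: gderiv_def)
  from has_derivative_compose[OF conv_has_derivative this]
  have "inner ?e (gradient (\<lambda>V. Loss (conv V X b)) W) = inner (conv ?e X 0) ?g"
    by (rule inner_gradient)
  moreover have "conv ?e X 0 = (\<chi> i j. X $ c $ (i + ix t) $ (j + ix s))"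
  proof -
    have "(\<Sum>c'\<in>UNIV. \<Sum>t'<CARD('k). \<Sum>s'<CARD('k). ?e $ c' $ ix t' $ ix s' * F c' t' s')
      = F c t s" for F :: "'c \<Rightarrow> nat \<Rightarrow> nat \<Rightarrow> real"
    proof -
      \<comment> \<open>The bounds on \<open>t\<close> and \<open>s\<close> make \<open>ix\<close>
        injective on the indices compared. The conditions are nested from the innermost sum
        outwards, so that each sum collapses in turn.\<close>
      have "(\<Sum>c'\<in>UNIV. \<Sum>t'<CARD('k). \<Sum>s'<CARD('k). ?e $ c' $ ix t' $ ix s' * F c' t' s')
        = (\<Sum>c'\<in>UNIV. \<Sum>t'<CARD('k). \<Sum>s'<CARD('k).
            if s' = s then (if t' = t then (if c' = c then F c' t' s' else 0) else 0) else 0)"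
        using ts by (intro sum.cong refl) (auto simp: axis_def ix_eq_iff)
      then show ?thesis using ts by (simp add: sum.delta)
    qed
    then show ?thesis by (simp add: conv_def vec_eq_iff)
  qed
  moreover have "inner ?e G = G $ c $ ix t $ ix s" for G
    by (simp add: inner_axis')
  ultimately show ?thesis by (simp only: inner_commute)
qed

lemma loss_freq_grad_eq_dft2:
  fixes Y :: "real ^ 'n::finite mod_ring ^ 'm::finite mod_ring"
  shows "loss_freq_grad Loss Y u v =
    1 / (of_nat CARD('m) * of_nat CARD('n)) * dft2 (gradient Loss Y) u v"
  unfolding loss_freq_grad_def dft2_def ..

text \<open>Parseval turns the inner product with the translated channel into a frequency sum; its
  factor \<open>M * N\<close> cancels the normalisation in \<open>loss_freq_grad\<close>.\<close>

lemma gradient_conv_freq: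
  fixes X :: "real ^ 'n::finite mod_ring ^ 'm::finite mod_ring ^ 'c::finite"
    and W :: "real ^ 'k::finite mod_ring ^ 'k mod_ring ^ 'c"
  assumes Loss: "Loss differentiable (at (conv W X b))" and ts: "t < CARD('k)" "s < CARD('k)"
  shows "complex_of_real (gradient (\<lambda>V. Loss (conv V X b)) W $ c $ ix t $ ix s) =
    (\<Sum>u<CARD('m). \<Sum>v<CARD('n). character u (ix t :: 'm mod_ring) * character v (ix s :: 'n mod_ring) *
      (loss_freq_grad Loss (conv W X b) u v * cnj (dft2 (X $ c) u v)))"
proof -
  let ?M = "CARD('m)" and ?N = "CARD('n)"
  let ?g = "gradient Loss (conv W X b)"
  let ?Z = "(\<chi> i j. X $ c $ (i + ix t) $ (j + ix s)) :: real ^ 'n mod_ring ^ 'm mod_ring"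
  \<comment> \<open>Characters have modulus 1, so conjugating the translation rule lets them move to
    the other side as their own inverses' conjugates.\<close>
  have shift: "character u (ix t :: 'm mod_ring) * character v (ix s :: 'n mod_ring) * cnj (dft2 (X $ c) u v)
      = cnj (dft2 ?Z u v)" for u v
  proof -
    let ?\<alpha> = "character u (ix t :: 'm mod_ring)" and ?\<beta> = "character v (ix s :: 'n mod_ring)"
    have "?\<alpha> * cnj ?\<alpha> = 1" "?\<beta> * cnj ?\<beta> = 1"
      by (simp_all flip: complex_norm_square)
    moreover have "?\<alpha> * ?\<beta> * cnj (dft2 (X $ c) u v) = (?\<alpha> * cnj ?\<alpha>) * (?\<beta> * cnj ?\<beta>) * cnj (dft2 ?Z u v)"
      unfolding dft2_translate[of "X $ c" "ix t" "ix s" u v, symmetric] by (simp add: mult_ac)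
    ultimately show ?thesis by simp
  qed
  have "(\<Sum>u<?M. \<Sum>v<?N. character u (ix t :: 'm mod_ring) * character v (ix s :: 'n mod_ring) *
      (loss_freq_grad Loss (conv W X b) u v * cnj (dft2 (X $ c) u v)))
    = (\<Sum>u<?M. \<Sum>v<?N. 1 / (of_nat ?M * of_nat ?N) * (dft2 ?g u v * cnj (dft2 ?Z u v)))"
    unfolding loss_freq_grad_eq_dft2 shift[symmetric] by (intro sum.cong refl) (simp add: mult_ac)
  also have "\<dots> = complex_of_real (inner ?g ?Z)"
    unfolding sum_distrib_left[symmetric] dft2_parseval by simp
  finally show ?thesis by (simp only: gradient_conv[OF Loss ts])
qed

section \<open>Change of the filter's frequency components\<close>

theorem theorem3p2:
  fixes X :: "real ^ 'n::finite mod_ring ^ 'm::finite mod_ring ^ 'c::finite"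
    and W W' :: "real ^ 'k::finite mod_ring ^ 'k mod_ring ^ 'c"
    and Y :: "real ^ 'n mod_ring ^ 'm mod_ring"
    and Loss :: "real ^ 'n mod_ring ^ 'm mod_ring \<Rightarrow> real"
    and b \<eta> u v :: real
  assumes "\<And>Z. Loss differentiable (at Z)"
    and "Y = conv W X b"
    and "W' = W - \<eta> *\<^sub>R gradient (\<lambda>V. Loss (conv V X b)) W"
    and "0 \<le> u" and "u < real CARD('m)"
    and "0 \<le> v" and "v < real CARD('n)"
  shows "filter_freq CARD('m) CARD('n) u v W' - filter_freq CARD('m) CARD('n) u v W =
    - (\<eta> *\<^sub>R (\<Sum>u'<CARD('m). \<Sum>v'<CARD('n).
        freq_coupling CARD('k) CARD('m) CARD('n) u v u' v' *s
          (loss_freq_grad Loss Y u' v' *s cnj_vec (feature_freq X u' v'))))"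
proof -
  let ?M = "CARD('m)" and ?N = "CARD('n)" and ?K = "CARD('k)"
  let ?D = "gradient (\<lambda>V. Loss (conv V X b)) W"
  let ?E = "\<lambda>t s. exp (\<i> * complex_of_real ((u * real t / real ?M + v * real s / real ?N) * (2 * pi)))"
  let ?\<phi> = "\<lambda>u' v' t s. character u' (ix t :: 'm mod_ring) * character v' (ix s :: 'n mod_ring)"
  \<comment> \<open>Linearity of the filter transform reduces the claim to the transform of the
    gradient.\<close>
  have linear: "filter_freq ?M ?N u v W' - filter_freq ?M ?N u v W = - (\<eta> *\<^sub>R filter_freq ?M ?N u v ?D)"
    unfolding assms(3)
    by (simp add: filter_freq_def vec_eq_iff scaleR_conv_of_real[where 'a = complex] left_diff_distrib sum_subtractf
        sum_distrib_left mult.assoc)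
  have "filter_freq ?M ?N u v ?D $ c = (\<Sum>u'<?M. \<Sum>v'<?N. freq_coupling ?K ?M ?N u v u' v' *
      (loss_freq_grad Loss Y u' v' * cnj (dft2 (X $ c) u' v')))" for c
  proof -
    \<comment> \<open>With frequencies packed into \<open>w\<close> and filter offsets into
      \<open>p\<close>, a single interchange brings the offset sum inside. That inner sum is the
      coupling coefficient, the same for every channel.\<close>
    let ?R = "\<lambda>w. loss_freq_grad Loss Y (fst w) (snd w) * cnj (dft2 (X $ c) (fst w) (snd w))"
    let ?F = "{..<?M} \<times> {..<?N}" and ?T = "{..<?K} \<times> {..<?K}"
    let ?h = "\<lambda>w p. ?E (fst p) (snd p) * ?\<phi> (fst w) (snd w) (fst p) (snd p) * ?R w"
    have "filter_freq ?M ?N u v ?D $ c = (\<Sum>t<?K. \<Sum>s<?K.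
        (\<Sum>u'<?M. \<Sum>v'<?N. ?\<phi> u' v' t s * (loss_freq_grad Loss Y u' v' * cnj (dft2 (X $ c) u' v')))
        * ?E t s)"
      unfolding filter_freq_def assms(2)
      by (simp add: gradient_conv_freq[OF assms(1)])
    also have "\<dots> = (\<Sum>p\<in>?T. \<Sum>w\<in>?F. ?h w p)"
      unfolding sum_distrib_right
      by (simp add: sum.cartesian_product' mult_ac)
    also have "\<dots> = (\<Sum>w\<in>?F. \<Sum>p\<in>?T. ?h w p)"
      by (rule sum.swap)
    also have "\<dots> = (\<Sum>w\<in>?F. freq_coupling ?K ?M ?N u v (fst w) (snd w) * ?R w)"
    proof (intro sum.cong refl)
      fix w assume "w \<in> ?F"
      then have "fst w < ?M" "snd w < ?N" by auto
      then show "(\<Sum>p\<in>?T. ?h w p) = freq_coupling ?K ?M ?N u v (fst w) (snd w) * ?R w"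
        by (simp only: freq_coupling_eq_sum[OF assms(4-7)] sum.cartesian_product sum_distrib_right
            case_prod_unfold)
    qed
    finally show ?thesis
      unfolding sum.cartesian_product by (simp only: case_prod_unfold)
  qed
  then have "filter_freq ?M ?N u v ?D = (\<Sum>u'<?M. \<Sum>v'<?N. freq_coupling ?K ?M ?N u v u' v' *s
      (loss_freq_grad Loss Y u' v' *s cnj_vec (feature_freq X u' v')))"
    by (simp add: vec_eq_iff cnj_vec_def feature_freq_def mult.assoc)
  then show ?thesis by (simp only: linear)
qed

end
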